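(* Let $s\in\mathbb{N}$ (with $s\ge 1$) and $x\in\mathbb{R}$ be fixed, and put $k_n=\frac{n}{s}(\log(n)+x)$. Let $Z_{n,s}(k_n)$ be the number of empty cells after $k_n$ drawings in the coupon collector's problem with $n$ cells and group size $s$, and let $W$ be a Poisson random variable with parameter $\lambda_n=\mathbb{E}[Z_{n,s}(k_n)]$. Then there exist a constant $\tilde C=\tilde C(s,x)\in(0,\infty)$ and a number $\tilde N=\tilde N(s,x)\in\mathbb{N}$, both depending only on $s$ and $x$, such that for all $n\ge\tilde N$ for which $k_n$ is a non-negative integer, $$d_{TV}(Z_{n,s}(k_n),W)\le\tilde C\,\frac{\log(n)}{n}.$$
   Context: Coupon collector's problem with group drawings: there are $n$ cells $C_1,\ldots,C_n$ (coupons), initially empty, and $s\le n$. In each drawing, a set of exactly $s$ distinct cells is chosen uniformly at random among all $\binom{n}{s}$ possible sets, independently of all other drawings, and one particle is placed into each of the chosen cells. For a non-negative integer $k$, let $E_{n,j}(k)$ be the event that cell $C_j$ contains no particle after $k$ drawings, and let $Z_{n,s}(k)=\sum_{j=1}^n\mathbf{1}_{E_{n,j}(k)}$ be the number of empty cells after $k$ drawings (equivalently, the number of coupons not drawn in the first $k$ drawings). The number of drawings $k_n$ is always assumed to be a non-negative integer. For real random variables $X,Y$, the total variation distance is $d_{TV}(X,Y)=\sup_{A}|\mathbb{P}(X\in A)-\mathbb{P}(Y\in A)|$, where the supremum is over all Borel sets $A\subset\mathbb{R}$. $\log$ denotes the natural logarithm. *)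

theory Defs
  imports "HOL-Probability.Probability"
begin

text \<open>
  The cells are labelled \<open>1, \<dots>, n\<close>. An outcome \<open>\<omega>\<close> of the first \<open>k\<close> drawings assigns to each
  \<open>i < k\<close> the set of cells chosen in drawing \<open>i\<close>. For \<open>s > n\<close> there are no groups and
  \<^const>\<open>pmf_of_set\<close> is unspecified, so \<open>s \<le> n\<close> is needed for the model to be meaningful.
\<close>

definition groups :: "nat \<Rightarrow> nat \<Rightarrow> nat set set" where
  "groups n s = {G. G \<subseteq> {1..n} \<and> card G = s}"

definition drawings :: "nat \<Rightarrow> nat \<Rightarrow> nat \<Rightarrow> (nat \<Rightarrow> nat set) pmf" where
  "drawings n s k = Pi_pmf {..<k} {} (\<lambda>_. pmf_of_set (groups n s))"

definition empty_event :: "nat \<Rightarrow> nat \<Rightarrow> (nat \<Rightarrow> nat set) set" where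
  "empty_event j k = {\<omega>. \<forall>i<k. j \<notin> \<omega> i}"

definition empty_cells :: "nat \<Rightarrow> nat \<Rightarrow> (nat \<Rightarrow> nat set) \<Rightarrow> real" where
  "empty_cells n k \<omega> = (\<Sum>j=1..n. indicator (empty_event j k) \<omega>)"

text \<open>
  The two random variables may live on different probability spaces, since only their laws matter.
  The supremum is taken over a nonempty set of reals that is bounded by \<open>1\<close> whenever \<open>M\<close> and
  \<open>N\<close> are probability spaces.
\<close>

definition tv_dist :: "'a measure \<Rightarrow> ('a \<Rightarrow> real) \<Rightarrow> 'b measure \<Rightarrow> ('b \<Rightarrow> real) \<Rightarrow> real" where
  "tv_dist M X N Y =
     (SUP A\<in>sets (borel :: real measure).
        \<bar>measure M (X -` A \<inter> space M) - measure N (Y -` A \<inter> space N)\<bar>)"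

end

theory Submission
  imports Defs
begin

text \<open>
  Expanding a test function \<open>h\<close> in binomial coefficients (Newton series) gives
  \<open>E h(Z) = \<Sum>r. d r * S r\<close>, where \<open>\<bar>d r\<bar> \<le> 2 ^ r\<close> if \<open>\<bar>h\<bar> \<le> 1\<close> and \<open>S r = E (Z choose r)\<close>; for
  the Poisson law with parameter \<open>\<lambda>\<close> the corresponding moments are \<open>\<lambda> ^ r / r!\<close>. For the number of
  empty cells, \<open>S r\<close> is explicit and satisfies
  \<open>\<lambda> ^ r / r! * (1 - c * r\<^sup>2) \<le> S r \<le> \<lambda> ^ r / r!\<close> with \<open>c = 1 / n + 4 * s * k / n\<^sup>2 = O(log n / n)\<close>.
  Since \<open>r\<^sup>2 \<le> 4 ^ r\<close> and \<open>\<lambda> \<le> exp (-x)\<close>, the total variation distance is at most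
  \<open>c * (\<Sum>r. (8 * \<lambda>) ^ r / r!) \<le> c * exp (8 * exp (-x))\<close>.
\<close>

section \<open>Newton series and the Poisson law\<close>

definition newton_coeff :: "(nat \<Rightarrow> real) \<Rightarrow> nat \<Rightarrow> real" where
  "newton_coeff h r = (\<Sum>j\<le>r. (-1) ^ (r - j) * real (r choose j) * h j)"

text \<open>\<open>newton_coeff h r\<close> is the \<open>r\<close>-th forward difference of
  \<open>h\<close> at 0, so this is Newton's interpolation formula. After swapping the sums, the
  coefficient of \<open>h j\<close> reduces to an alternating row sum of binomials of
  \<open>m - j\<close>, which vanishes unless \<open>j = m\<close>.\<close>

lemma newton_expansion:
  "h m = (\<Sum>r\<le>m. real (m choose r) * newton_coeff h r)"
proof -
  have "(\<Sum>r\<le>m. real (m choose r) * newton_coeff h r) =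
      (\<Sum>r\<in>{..m}. \<Sum>j | j \<in> {..m} \<and> j \<le> r. (-1) ^ (r - j) * real (m choose r) * real (r choose j) * h j)"
    unfolding newton_coeff_def sum_distrib_left
    by (intro sum.cong) (auto simp: algebra_simps)
  also have "\<dots> = (\<Sum>j\<in>{..m}. \<Sum>r | r \<in> {..m} \<and> j \<le> r.
      (-1) ^ (r - j) * real (m choose r) * real (r choose j) * h j)"
    by (rule sum.swap_restrict) auto
  also have "\<dots> = (\<Sum>j\<in>{..m}. if j = m then h j else 0)"
  proof (intro sum.cong refl)
    fix j assume "j \<in> {..m}"
    then have j: "j \<le> m" by simp
    have "(\<Sum>r | r \<in> {..m} \<and> j \<le> r. (-1) ^ (r - j) * real (m choose r) * real (r choose j) * h j)
        = (\<Sum>i\<le>m - j. (-1) ^ i * real (m choose (i + j)) * real ((i + j) choose j) * h j)"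
      by (rule sum.reindex_bij_witness[of _ "\<lambda>i. i + j" "\<lambda>r. r - j"]) (use j in auto)
    also have "\<dots> = (\<Sum>i\<le>m - j. real (m choose j) * h j * ((-1) ^ i * real ((m - j) choose i)))"
    proof (intro sum.cong refl)
      fix i assume "i \<in> {..m - j}"
      then have "(m choose (i + j)) * ((i + j) choose j) = (m choose j) * ((m - j) choose i)"
        using choose_mult[of j "i + j" m] j by simp
      then have "real (m choose (i + j)) * real ((i + j) choose j) = real (m choose j) * real ((m - j) choose i)"
        by (metis of_nat_mult)
      then show "(-1) ^ i * real (m choose (i + j)) * real ((i + j) choose j) * h j =
          real (m choose j) * h j * ((-1) ^ i * real ((m - j) choose i))"
        by simp
    qed
    also have "\<dots> = real (m choose j) * h j * (\<Sum>i\<le>m - j. (-1) ^ i * real ((m - j) choose i))"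
      by (simp add: sum_distrib_left)
    also have "\<dots> = (if j = m then h j else 0)"
      using choose_alternating_sum[of "m - j", where 'a = real] j by auto
    finally show "(\<Sum>r | r \<in> {..m} \<and> j \<le> r. (-1) ^ (r - j) * real (m choose r) * real (r choose j) * h j)
        = (if j = m then h j else 0)" .
  qed
  also have "\<dots> = h m" by simp
  finally show ?thesis by simp
qed

lemma newton_coeff_bound:
  assumes "\<And>j. \<bar>h j\<bar> \<le> 1"
  shows "\<bar>newton_coeff h r\<bar> \<le> 2 ^ r"
proof -
  have "\<bar>newton_coeff h r\<bar> \<le> (\<Sum>j\<le>r. \<bar>(-1) ^ (r - j) * real (r choose j) * h j\<bar>)"
    unfolding newton_coeff_def by (rule sum_abs)
  also have "\<dots> \<le> (\<Sum>j\<le>r. real (r choose j))"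
    using assms by (intro sum_mono) (simp add: abs_mult power_abs mult_left_le)
  also have "\<dots> = 2 ^ r"
    using choose_row_sum[of r] by (metis of_nat_sum of_nat_power of_nat_numeral)
  finally show ?thesis .
qed

text \<open>The binomial moments of the Poisson law are \<open>lam ^ r / fact r\<close>. Writing the
  expectation as a series with the same coefficients as for the empty cells permits a termwise
  comparison.\<close>

lemma poisson_newton_sums:
  assumes lam: "lam > 0" and h: "\<And>j. \<bar>h j\<bar> \<le> 1"
  shows "(\<lambda>r. lam ^ r / fact r * newton_coeff h r) sums
    measure_pmf.expectation (poisson_pmf lam) h"
proof -
  let ?a = "\<lambda>j. lam ^ j / fact j * h j"
  let ?b = "\<lambda>i. (-lam) ^ i / fact i"
  have sexp: "summable (\<lambda>i. y ^ i / fact i)" for y :: real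
    using summable_exp[of y] by (simp add: field_simps)
  have sa: "summable (\<lambda>j. norm (?a j))"
  proof (rule summable_comparison_test'[OF sexp[of lam]])
    show "norm (norm (?a j)) \<le> lam ^ j / fact j" for j
      using lam mult_left_le[OF h[of j], of "lam ^ j / fact j"] by (simp add: abs_mult)
  qed
  have sb: "summable (\<lambda>i. norm (?b i))"
    using sexp[of lam] lam by (simp add: power_abs)
  txt \<open>The claimed series is the Cauchy product of \<open>\<Sum>j. lam ^ j / j! * h j\<close> with the series
    of \<open>exp (-lam)\<close>.\<close>
  have "(\<lambda>r. \<Sum>j\<le>r. ?a j * ?b (r - j)) sums ((\<Sum>j. ?a j) * (\<Sum>i. ?b i))"
    by (rule Cauchy_product_sums[OF sa sb])
  also have "(\<lambda>r. \<Sum>j\<le>r. ?a j * ?b (r - j)) = (\<lambda>r. lam ^ r / fact r * newton_coeff h r)"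
  proof
    fix r
    show "(\<Sum>j\<le>r. ?a j * ?b (r - j)) = lam ^ r / fact r * newton_coeff h r"
      unfolding newton_coeff_def sum_distrib_left
    proof (intro sum.cong refl)
      fix j assume "j \<in> {..r}"
      then have j: "j \<le> r" by simp
      have "lam ^ r = lam ^ j * lam ^ (r - j)"
        using j by (simp add: power_add[symmetric])
      moreover have "(-lam) ^ (r - j) = (-1) ^ (r - j) * lam ^ (r - j)"
        by (rule power_minus)
      ultimately show "?a j * ?b (r - j) =
          lam ^ r / fact r * ((-1) ^ (r - j) * real (r choose j) * h j)"
        using binomial_fact[OF j, where 'a = real] by simp
    qed
  qed
  also have "(\<Sum>i. ?b i) = exp (-lam)"
    by (simp add: exp_def divide_inverse mult.commute)
  also have "(\<Sum>j. ?a j) * exp (-lam) = measure_pmf.expectation (poisson_pmf lam) h"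
  proof -
    \<comment> \<open>The expectation is read as an integral over the counting measure, which
      absolute summability turns into a series.\<close>
    have eq: "(\<lambda>j. pmf (poisson_pmf lam) j *\<^sub>R h j) = (\<lambda>j. exp (-lam) * ?a j)"
      using lam by (simp add: fun_eq_iff)
    have "summable (\<lambda>j. norm (exp (-lam) * ?a j))"
      using summable_mult[OF sa, of "exp (-lam)"] by (simp add: abs_mult)
    then have "integrable (count_space UNIV) (\<lambda>j. exp (-lam) * ?a j)"
      by (simp add: integrable_count_space_nat_iff)
    then have "(\<integral>j. exp (-lam) * ?a j \<partial>count_space UNIV) = (\<Sum>j. exp (-lam) * ?a j)"
      by (rule integral_count_space_nat)
    also have "\<dots> = exp (-lam) * (\<Sum>j. ?a j)"
      by (rule suminf_mult[OF summable_norm_cancel[OF sa]])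
    finally have "(\<integral>j. exp (-lam) * ?a j \<partial>count_space UNIV) = exp (-lam) * (\<Sum>j. ?a j)" .
    moreover have "measure_pmf.expectation (poisson_pmf lam) h =
        (\<integral>j. pmf (poisson_pmf lam) j *\<^sub>R h j \<partial>count_space UNIV)"
      unfolding measure_pmf_eq_density by (rule integral_density) auto
    ultimately show ?thesis
      unfolding eq by simp
  qed
  finally show ?thesis .
qed

section \<open>Binomial moments of the number of empty cells\<close>

lemma finite_groups [simp]: "finite (groups n s)"
  unfolding groups_def by simp

lemma card_groups_avoiding:
  assumes "J \<subseteq> {1..n}"
  shows "card (groups n s \<inter> {G. G \<inter> J = {}}) = (n - card J) choose s"
proof -
  have "groups n s \<inter> {G. G \<inter> J = {}} = {G. G \<subseteq> {1..n} - J \<and> card G = s}"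
    unfolding groups_def by auto
  then show ?thesis
    using assms by (simp add: n_subsets card_Diff_subset finite_subset)
qed

lemma card_groups: "card (groups n s) = n choose s"
  using card_groups_avoiding[of "{}" n s] by simp

text \<open>The event is a product set over the drawings, each of which must avoid \<open>J\<close>,
  so independence gives a \<open>k\<close>-th power. The condition \<open>s \<le> n\<close> makes
  \<open>groups n s\<close> nonempty, so that \<open>pmf_of_set\<close> is the uniform law.\<close>

lemma prob_all_empty:
  assumes "s \<le> n" "J \<subseteq> {1..n}"
  shows "measure_pmf.prob (drawings n s k) {\<omega>. \<forall>j\<in>J. \<omega> \<in> empty_event j k} =
    (real ((n - card J) choose s) / real (n choose s)) ^ k"
proof -
  have "card (groups n s) > 0"
    using assms by (simp add: card_groups)
  then have ne: "groups n s \<noteq> {}" by auto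
  have "{\<omega>. \<forall>j\<in>J. \<omega> \<in> empty_event j k} = Pi {..<k} (\<lambda>_. {G. G \<inter> J = {}})"
    unfolding empty_event_def by auto
  then show ?thesis
    using card_groups_avoiding[OF assms(2), of s] card_groups[of n s]
    by (simp add: drawings_def measure_Pi_pmf_Pi measure_pmf_of_set[OF ne])
qed

lemma empty_cells_eq_card:
  "empty_cells n k \<omega> = real (card {j \<in> {1..n}. \<omega> \<in> empty_event j k})"
proof -
  have "empty_cells n k \<omega> = (\<Sum>j\<in>{1..n}. if \<omega> \<in> empty_event j k then 1 else 0)"
    unfolding empty_cells_def by (intro sum.cong) (auto simp: indicator_def)
  then show ?thesis
    by (simp add: sum.If_cases Int_def)
qed

text \<open>Closed form of E(Z choose r) for the number Z of empty cells: the number of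
  \<open>r\<close>-sets of cells times the probability that a given one stays empty. The case
  \<open>r = 1\<close> is the mean.\<close>

definition binomial_moment :: "nat \<Rightarrow> nat \<Rightarrow> nat \<Rightarrow> nat \<Rightarrow> real" where
  "binomial_moment n s k r =
     real (n choose r) * (real ((n - r) choose s) / real (n choose s)) ^ k"

lemma integrable_drawings:
  fixes f :: "(nat \<Rightarrow> nat set) \<Rightarrow> real"
  assumes "s \<le> n"
  shows "integrable (measure_pmf (drawings n s k)) f"
proof (rule integrable_measure_pmf_finite)
  have "card (groups n s) > 0"
    using assms by (simp add: card_groups)
  then have ne: "groups n s \<noteq> {}" by auto
  have "set_pmf (drawings n s k) \<subseteq> PiE_dflt {..<k} {} (\<lambda>_. groups n s)"
    using set_Pi_pmf_subset'[of "{..<k}" "{}" "\<lambda>_. pmf_of_set (groups n s)"] ne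
    by (simp add: drawings_def comp_def)
  then show "finite (set_pmf (drawings n s k))"
    by (rule finite_subset) (auto intro!: finite_PiE_dflt)
qed

text \<open>The binomial coefficient counts the \<open>r\<close>-sets consisting of empty cells
  only. Linearity reduces its expectation to a sum of probabilities that depend on the size of the
  set alone.\<close>

lemma expectation_choose_empty_cells:
  assumes "s \<le> n"
  shows "measure_pmf.expectation (drawings n s k)
      (\<lambda>\<omega>. real (card {j \<in> {1..n}. \<omega> \<in> empty_event j k} choose r)) = binomial_moment n s k r"
proof -
  let ?\<J> = "{J. J \<subseteq> {1..n} \<and> card J = r}"
  let ?E = "\<lambda>J. {\<omega>. \<forall>j\<in>J. \<omega> \<in> empty_event j k}"
  have fin: "finite ?\<J>" by simp
  have "real (card {j \<in> {1..n}. \<omega> \<in> empty_event j k} choose r) = (\<Sum>J\<in>?\<J>. indicator (?E J) \<omega>)" for \<omega>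
  proof -
    have "card {j \<in> {1..n}. \<omega> \<in> empty_event j k} choose r =
        card {J. J \<subseteq> {j \<in> {1..n}. \<omega> \<in> empty_event j k} \<and> card J = r}"
      by (simp add: n_subsets)
    also have "{J. J \<subseteq> {j \<in> {1..n}. \<omega> \<in> empty_event j k} \<and> card J = r} = ?\<J> \<inter> {J. \<omega> \<in> ?E J}"
      by auto
    finally have "real (card {j \<in> {1..n}. \<omega> \<in> empty_event j k} choose r) = real (card (?\<J> \<inter> {J. \<omega> \<in> ?E J}))"
      by simp
    also have "\<dots> = (\<Sum>J\<in>?\<J>. if \<omega> \<in> ?E J then 1 else 0)"
      using fin by (simp add: sum.If_cases)
    finally show ?thesis
      by (simp add: indicator_def of_bool_def)
  qed
  then have "measure_pmf.expectation (drawings n s k)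
      (\<lambda>\<omega>. real (card {j \<in> {1..n}. \<omega> \<in> empty_event j k} choose r)) =
      (\<Sum>J\<in>?\<J>. measure_pmf.prob (drawings n s k) (?E J))"
    by (simp add: integrable_drawings[OF assms])
  also have "\<dots> = (\<Sum>J\<in>?\<J>. (real ((n - r) choose s) / real (n choose s)) ^ k)"
    using prob_all_empty[OF assms] by (intro sum.cong) auto
  also have "\<dots> = binomial_moment n s k r"
    by (simp add: binomial_moment_def n_subsets)
  finally show ?thesis .
qed

lemma expectation_empty_cells:
  assumes "s \<le> n"
  shows "measure_pmf.expectation (drawings n s k) (empty_cells n k) = binomial_moment n s k 1"
  using expectation_choose_empty_cells[OF assms, of k 1] by (simp add: empty_cells_eq_card[abs_def])

lemma binomial_moment_eq_0:
  "r > n \<Longrightarrow> binomial_moment n s k r = 0"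
  by (simp add: binomial_moment_def)

text \<open>There are at most \<open>n\<close> empty cells, so the Newton expansion is a finite sum
  up to \<open>n\<close>. It is stated as an infinite series so that the Poisson series can be
  subtracted from it.\<close>

lemma empty_cells_newton_sums:
  assumes "s \<le> n"
  shows "(\<lambda>r. binomial_moment n s k r * newton_coeff h r) sums
    measure_pmf.expectation (drawings n s k)
      (\<lambda>\<omega>. h (card {j \<in> {1..n}. \<omega> \<in> empty_event j k}))"
proof -
  let ?Z = "\<lambda>\<omega>. card {j \<in> {1..n}. \<omega> \<in> empty_event j k}"
  have Z: "?Z \<omega> \<le> n" for \<omega>
    using card_mono[of "{1..n}" "{j \<in> {1..n}. \<omega> \<in> empty_event j k}"] by (metis (lifting) card_atLeastAtMost diff_Suc_1 finite_atLeastAtMost mem_Collect_eq subsetI)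
  have "h (?Z \<omega>) = (\<Sum>r\<le>n. real (?Z \<omega> choose r) * newton_coeff h r)" for \<omega>
    by (subst newton_expansion, rule sum.mono_neutral_left) (use Z in \<open>auto simp: binomial_eq_0\<close>)
  then have "measure_pmf.expectation (drawings n s k) (\<lambda>\<omega>. h (?Z \<omega>)) =
      (\<Sum>r\<le>n. measure_pmf.expectation (drawings n s k) (\<lambda>\<omega>. real (?Z \<omega> choose r)) * newton_coeff h r)"
    by (simp add: integrable_drawings[OF assms])
  also have "\<dots> = (\<Sum>r\<le>n. binomial_moment n s k r * newton_coeff h r)"
    by (simp only: expectation_choose_empty_cells[OF assms])
  finally show ?thesis
    using sums_finite[of "{..n}" "\<lambda>r. binomial_moment n s k r * newton_coeff h r"]
    by (simp add: binomial_moment_eq_0)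
qed

section \<open>Two-sided bounds on the binomial moments\<close>

lemma binomial_moment_nonneg: "binomial_moment n s k r \<ge> 0"
  by (simp add: binomial_moment_def)

lemma binomial_moment_0:
  "s \<le> n \<Longrightarrow> binomial_moment n s k 0 = 1"
  by (simp add: binomial_moment_def)

text \<open>The ratio of consecutive moments, from the absorption identities; it drives the
  inductions for both bounds. Truncated subtraction is harmless: for \<open>n \<le> r + s\<close>
  both sides involve a vanishing binomial or factor.\<close>

lemma binomial_moment_Suc:
  assumes "r < n"
  shows "binomial_moment n s k (Suc r) = binomial_moment n s k r *
    (real (n - r) / real (Suc r)) * (real (n - r - s) / real (n - r)) ^ k"
proof -
  have "real (Suc r) * real (n choose Suc r) = real (n - r) * real (n choose r)"
    using binomial_absorption[of r n] binomial_absorb_comp[of n r] by (metis of_nat_mult)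
  then have 1: "real (n choose Suc r) = real (n choose r) * (real (n - r) / real (Suc r))"
    by (simp add: field_simps)
  have "real (n - r - s) * real ((n - r) choose s) = real (n - r) * real ((n - Suc r) choose s)"
    using binomial_absorb_comp[of "n - r" s] by (metis of_nat_mult diff_diff_left add.commute plus_1_eq_Suc)
  then have 2: "real ((n - Suc r) choose s) = real ((n - r) choose s) * (real (n - r - s) / real (n - r))"
    using assms by (simp add: field_simps)
  show ?thesis
    unfolding binomial_moment_def 1 2 by (simp add: power_mult_distrib power_divide mult_ac)
qed

lemma binomial_moment_1:
  assumes "s \<le> n" "0 < n"
  shows "binomial_moment n s k 1 = real n * (real (n - s) / real n) ^ k"
  using binomial_moment_Suc[of 0 n s k] assms by (simp add: binomial_moment_0)

text \<open>Both factors of the ratio decrease when \<open>n - r\<close> replaces \<open>n\<close>: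
  emptiness of different cells is negatively correlated.\<close>

lemma binomial_moment_le:
  assumes "s \<le> n" "0 < n"
  shows "binomial_moment n s k r \<le> binomial_moment n s k 1 ^ r / fact r"
proof (induction r)
  case 0
  then show ?case using assms by (simp add: binomial_moment_0)
next
  case (Suc r)
  let ?lam = "binomial_moment n s k 1"
  show ?case
  proof (cases "r < n")
    case False
    then show ?thesis
      by (simp add: binomial_moment_eq_0 binomial_moment_nonneg)
  next
    case True
    have "real (n - r - s) / real (n - r) \<le> real (n - s) / real n"
    proof (cases "r + s \<le> n")
      case True
      then show ?thesis
        using \<open>r < n\<close> assms by (simp add: divide_simps of_nat_diff algebra_simps)
    qed (use \<open>r < n\<close> in simp)
    then have "(real (n - r - s) / real (n - r)) ^ k \<le> (real (n - s) / real n) ^ k"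
      by (intro power_mono) auto
    then have "binomial_moment n s k (Suc r) \<le> (?lam ^ r / fact r) *
        (real n / real (Suc r)) * (real (n - s) / real n) ^ k"
      unfolding binomial_moment_Suc[OF True]
      by (intro mult_mono Suc.IH divide_right_mono mult_nonneg_nonneg divide_nonneg_nonneg
          zero_le_power binomial_moment_nonneg) auto
    also have "\<dots> = ?lam ^ Suc r / fact (Suc r)"
      unfolding binomial_moment_1[OF assms] by (simp add: mult_ac)
    finally show ?thesis .
  qed
qed

text \<open>Passing from \<open>r\<close> to \<open>Suc r\<close> multiplies the moment by at least
  \<open>lam / (r + 1) * (1 - c * r)\<close>, where \<open>lam\<close> is the mean. The losses
  accumulate to order \<open>c * r^2\<close>, because
  \<open>r^2 + r \<le> (r + 1)^2\<close>.\<close>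

lemma binomial_moment_ge:
  assumes n: "n \<ge> 4" "2 * s \<le> n"
    and c: "c = 1 / real n + 4 * real s * real k / (real n)\<^sup>2"
  shows "binomial_moment n s k 1 ^ r / fact r * (1 - c * (real r)\<^sup>2) \<le> binomial_moment n s k r"
proof (induction r)
  case 0
  then show ?case using n by (simp add: binomial_moment_0)
next
  case (Suc r)
  let ?lam = "binomial_moment n s k 1"
  have sn: "s \<le> n" "0 < n" using n by auto
  have c0: "c \<ge> 0" using c by simp
  have lam0: "?lam \<ge> 0" by (rule binomial_moment_nonneg)
  show ?case
  \<comment> \<open>If this holds, the claimed lower bound is not positive. Otherwise
    \<open>c \<ge> 1 / n\<close> forces \<open>r\<close> to be small compared with
    \<open>n\<close>.\<close>
  proof (cases "c * (real (Suc r))\<^sup>2 \<ge> 1")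
    case True
    then have "?lam ^ Suc r / fact (Suc r) * (1 - c * (real (Suc r))\<^sup>2) \<le> 0"
      using lam0 by (intro mult_nonneg_nonpos) auto
    then show ?thesis
      using binomial_moment_nonneg order_trans by blast
  next
    case False
    have r: "2 * r < n"
    proof (rule ccontr)
      assume "\<not> 2 * r < n"
      then have "real n / 2 \<le> real (Suc r)" by simp
      then have "(real n / 2)\<^sup>2 \<le> (real (Suc r))\<^sup>2" by (intro power_mono) auto
      moreover have "1 / real n \<le> c" using c by simp
      ultimately have "1 / real n * (real n / 2)\<^sup>2 \<le> c * (real (Suc r))\<^sup>2"
        by (intro mult_mono) (auto simp: c0)
      moreover have "1 / real n * (real n / 2)\<^sup>2 = real n / 4"
        using n by (simp add: power2_eq_square)
      ultimately have "real n / 4 < 1" using False by linarith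
      then show False using n by simp
    qed
    then have "r < n" by simp
    \<comment> \<open>The exact relative loss in the ratio is
      \<open>r * s / ((n - r) * (n - s))\<close>. It is at most \<open>b\<close> because
      \<open>n - r\<close> and \<open>n - s\<close> are both at least \<open>n / 2\<close>. Moreover
      \<open>k * b\<close> is the second summand of \<open>c\<close> times \<open>r\<close>.\<close>
    define b where "b = 4 * real r * real s / (real n)\<^sup>2"
    have "4 * real r * real s = (2 * real r) * (2 * real s)" by simp
    also have "\<dots> \<le> real n * real n"
      using r n by (intro mult_mono) auto
    finally have b1: "b \<le> 1"
      using n by (simp add: b_def power2_eq_square)
    have ratio: "(real (n - s) / real n) * (1 - b) \<le> real (n - r - s) / real (n - r)"
    proof -
      have rn: "real n - real r > 0" "real n - real s > 0" "real n > 0" using r n by auto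
      have "real n * real n / 4 = (real n / 2) * (real n / 2)" by simp
      also have "\<dots> \<le> (real n - real r) * (real n - real s)"
        using r n by (intro mult_mono) auto
      finally have "real r * real s / ((real n - real r) * (real n - real s)) \<le> b"
        using frac_le[of "real r * real s" "real r * real s" "real n * real n / 4"] rn
        by (simp add: b_def power2_eq_square mult_ac)
      then have "(real (n - s) / real n) * (1 - b) \<le>
          (real (n - s) / real n) * (1 - real r * real s / ((real n - real r) * (real n - real s)))"
        by (intro mult_left_mono) auto
      \<comment> \<open>This rests on
        \<open>(n - r) * (n - s) - r * s = n * (n - r - s)\<close>.\<close>
      also have "\<dots> = (real n - real r - real s) / (real n - real r)"
        using rn sn by (simp add: of_nat_diff divide_simps) (simp add: algebra_simps)
      also have "\<dots> \<le> real (n - r - s) / real (n - r)"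
        using r by (auto simp: of_nat_diff intro!: divide_right_mono)
      finally show ?thesis .
    qed
    have b0: "b \<ge> 0" by (simp add: b_def)
    \<comment> \<open>Bernoulli's inequality linearises the \<open>k\<close>-th power; the
      nonnegative cross term \<open>r / n * (k * b)\<close> is dropped afterwards.\<close>
    have "1 - real k * b \<le> (1 - b) ^ k"
      using Bernoulli_inequality[of "- b" k] b1 by simp
    have "(1 - real r / real n) * (1 - real k * b) \<le> (1 - real r / real n) * (1 - b) ^ k"
      using r by (intro mult_left_mono \<open>1 - real k * b \<le> (1 - b) ^ k\<close>) auto
    moreover have "1 - c * real r = 1 - real r / real n - real k * b"
      by (simp add: c b_def algebra_simps)
    moreover have "0 \<le> real r / real n * (real k * b)" using b0 by simp
    ultimately have step: "1 - c * real r \<le> (1 - real r / real n) * (1 - b) ^ k"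
      by (simp add: algebra_simps)
    have "c * real r \<le> c * (real (Suc r))\<^sup>2"
      by (intro mult_left_mono c0) (simp add: power2_eq_square algebra_simps)
    then have cr: "0 \<le> 1 - c * real r" using False by simp
    have "?lam ^ Suc r / fact (Suc r) * (1 - c * (real (Suc r))\<^sup>2) \<le>
        ?lam ^ Suc r / fact (Suc r) * ((1 - c * (real r)\<^sup>2) * (1 - c * real r))"
    proof (rule mult_left_mono)
      have "0 \<le> c * c * (real r)\<^sup>2 * real r" "0 \<le> c * real r" using c0 by auto
      then show "1 - c * (real (Suc r))\<^sup>2 \<le> (1 - c * (real r)\<^sup>2) * (1 - c * real r)"
        using c0 by (simp add: power2_eq_square algebra_simps)
    qed (use lam0 in simp)
    also have "\<dots> = (?lam ^ r / fact r * (1 - c * (real r)\<^sup>2)) * (?lam / real (Suc r) * (1 - c * real r))"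
      by (simp add: mult_ac)
    also have "\<dots> \<le> binomial_moment n s k r * (?lam / real (Suc r) * (1 - c * real r))"
      using lam0 cr by (intro mult_right_mono Suc.IH) auto
    also have "\<dots> \<le> binomial_moment n s k r * (?lam / real (Suc r) * ((1 - real r / real n) * (1 - b) ^ k))"
      using lam0 by (intro mult_left_mono step binomial_moment_nonneg) auto
    also have "\<dots> = binomial_moment n s k r * (real (n - r) / real (Suc r)) *
        ((real (n - s) / real n) * (1 - b)) ^ k"
    proof -
      have "real (n - r) = real n * (1 - real r / real n)"
        using r by (simp add: of_nat_diff right_diff_distrib)
      then show ?thesis
        unfolding binomial_moment_1[OF sn] power_mult_distrib by (simp only:) (simp add: mult_ac)
    qed
    also have "\<dots> \<le> binomial_moment n s k (Suc r)"
      unfolding binomial_moment_Suc[OF \<open>r < n\<close>]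
      using ratio b1
      by (intro mult_left_mono power_mono mult_nonneg_nonneg binomial_moment_nonneg) auto
    finally show ?thesis .
  qed
qed

section \<open>Total variation bound and choice of constants\<close>

lemma tv_dist_empty_cells_poisson:
  assumes n: "n \<ge> 4" "2 * s \<le> n" "s < n"
    and lam: "lam = binomial_moment n s k 1"
  shows "tv_dist (measure_pmf (drawings n s k)) (empty_cells n k) (measure_pmf (poisson_pmf lam)) real
    \<le> (1 / real n + 4 * real s * real k / (real n)\<^sup>2) * exp (8 * lam)"
  unfolding tv_dist_def
proof (rule cSUP_least)
  show "sets (borel :: real measure) \<noteq> {}" using sets.top by blast
next
  fix A :: "real set" assume "A \<in> sets borel"
  let ?c = "1 / real n + 4 * real s * real k / (real n)\<^sup>2"
  let ?Z = "\<lambda>\<omega>. card {j \<in> {1..n}. \<omega> \<in> empty_event j k}"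
  \<comment> \<open>Both variables take natural values, so a Borel set matters only through its
    trace on the naturals.\<close>
  define h where "h = (\<lambda>m. indicator A (real m) :: real)"
  have h: "\<bar>h j\<bar> \<le> 1" for j by (simp add: h_def indicator_def)
  have sn: "s \<le> n" "0 < n" using n by auto
  have lam0: "lam > 0"
    unfolding lam binomial_moment_1[OF sn] using n by simp
  have "(\<lambda>r. binomial_moment n s k r * newton_coeff h r - lam ^ r / fact r * newton_coeff h r) sums
    (measure_pmf.expectation (drawings n s k) (\<lambda>\<omega>. h (?Z \<omega>)) -
     measure_pmf.expectation (poisson_pmf lam) h)" (is "?f sums (?P - ?Q)")
    by (intro sums_diff empty_cells_newton_sums poisson_newton_sums sn lam0 h)
  moreover have "(\<lambda>r. ?c * ((8 * lam) ^ r / fact r)) sums (?c * exp (8 * lam))"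
    using exp_converges[of "8 * lam"] by (intro sums_mult) (simp add: field_simps)
  moreover have "norm (?f r) \<le> ?c * ((8 * lam) ^ r / fact r)" for r
  proof -
    have "\<bar>binomial_moment n s k r - lam ^ r / fact r\<bar> \<le> lam ^ r / fact r * (?c * (real r)\<^sup>2)"
      using binomial_moment_le[OF sn, of k r] binomial_moment_ge[OF n(1,2) refl, of k r]
      by (simp add: lam right_diff_distrib)
    moreover have "(real r)\<^sup>2 \<le> (2 ^ r)\<^sup>2"
      using less_exp[of r] by (intro power_mono) (auto simp: less_imp_le)
    then have "(real r)\<^sup>2 \<le> 4 ^ r"
      by (simp add: power2_eq_square power_mult_distrib[symmetric])
    then have "lam ^ r / fact r * (?c * (real r)\<^sup>2) \<le> lam ^ r / fact r * (?c * 4 ^ r)"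
      using lam0 by (intro mult_left_mono) auto
    ultimately have "\<bar>binomial_moment n s k r - lam ^ r / fact r\<bar> * \<bar>newton_coeff h r\<bar> \<le>
        lam ^ r / fact r * (?c * 4 ^ r) * 2 ^ r"
      using lam0 by (intro mult_mono newton_coeff_bound h) auto
    \<comment> \<open>The 8 arises as 4 from \<open>r^2 \<le> 4 ^ r\<close> times 2 from the bound
      on the Newton coefficients.\<close>
    also have "\<dots> = ?c * (((4 * 2) * lam) ^ r / fact r)"
      unfolding power_mult_distrib by simp
    finally show ?thesis
      by (simp add: abs_mult[symmetric] left_diff_distrib)
  qed
  ultimately have "norm (?P - ?Q) \<le> ?c * exp (8 * lam)"
    by (rule norm_sums_le)
  moreover have "measure_pmf.prob (drawings n s k) (empty_cells n k -` A) = ?P"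
  proof -
    have "(\<lambda>\<omega>. h (?Z \<omega>)) = indicator (empty_cells n k -` A)"
      by (simp add: fun_eq_iff h_def empty_cells_eq_card indicator_def)
    then show ?thesis by simp
  qed
  moreover have "measure_pmf.prob (poisson_pmf lam) (real -` A) = ?Q"
    by (simp add: h_def flip: indicator_vimage)
  ultimately show "\<bar>measure_pmf.prob (drawings n s k) (empty_cells n k -` A \<inter> space (measure_pmf (drawings n s k))) -
      measure_pmf.prob (poisson_pmf lam) (real -` A \<inter> space (measure_pmf (poisson_pmf lam)))\<bar> \<le> ?c * exp (8 * lam)"
    by simp
qed

theorem theorem3:
  fixes s :: nat and x :: real
  assumes "s \<ge> 1"
  shows "\<exists>C N. C > (0 :: real) \<and>
    (\<forall>n\<ge>(N :: nat). \<forall>k :: nat.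
       s \<le> n \<and> real k = real n / real s * (ln (real n) + x) \<longrightarrow>
       (let lam = measure_pmf.expectation (drawings n s k) (empty_cells n k)
        in tv_dist (measure_pmf (drawings n s k)) (empty_cells n k)
                   (measure_pmf (poisson_pmf lam)) (\<lambda>w. real w)
             \<le> C * (ln (real n) / real n)))"
proof -
  \<comment> \<open>The first factor bounds \<open>c * n / ln n\<close> once
    \<open>ln n \<ge> 1\<close>; the second comes from the mean being at most
    \<open>exp (-x)\<close>. The threshold \<open>2 * s + 4\<close> secures
    \<open>2 * s \<le> n\<close> and \<open>n \<ge> 4\<close>, hence
    \<open>ln n \<ge> 1\<close>.\<close>
  let ?C = "(5 + 4 * \<bar>x\<bar>) * exp (8 * exp (-x))"
  have "tv_dist (measure_pmf (drawings n s k)) (empty_cells n k) (measure_pmf (poisson_pmf lam)) real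
      \<le> ?C * (ln (real n) / real n)"
    if nN: "n \<ge> 2 * s + 4" and k: "real k = real n / real s * (ln (real n) + x)"
      and lam_eq: "lam = measure_pmf.expectation (drawings n s k) (empty_cells n k)" for n k lam
  proof -
    have n: "n \<ge> 4" "2 * s \<le> n" "s < n" "s \<le> n" "0 < n" using nN by auto
    have lam: "lam = binomial_moment n s k 1"
      unfolding lam_eq by (rule expectation_empty_cells[OF n(4)])
    \<comment> \<open>The mean is \<open>n * (1 - s / n) ^ k\<close>, at most
      \<open>n * exp (- s * k / n)\<close>, which equals \<open>exp (-x)\<close> by the choice of
      \<open>k\<close>.\<close>
    have "real (n - s) / real n = 1 + (- (real s / real n))"
      using n by (simp add: of_nat_diff field_simps)
    also have "\<dots> \<le> exp (- (real s / real n))"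
      by (rule exp_ge_add_one_self)
    finally have "(real (n - s) / real n) ^ k \<le> exp (- (real s / real n)) ^ k"
      by (intro power_mono) auto
    also have "\<dots> = exp (- (ln (real n) + x))"
      using n assms by (simp add: exp_of_nat_mult[symmetric] k)
    also have "\<dots> = exp (-x) / real n"
      using n by (simp add: exp_add[symmetric] exp_diff exp_minus field_simps)
    finally have "real n * (real (n - s) / real n) ^ k \<le> real n * (exp (-x) / real n)"
      by (rule mult_left_mono) simp
    then have "lam \<le> exp (-x)"
      unfolding lam binomial_moment_1[OF n(4,5)] using n by simp
    then have el: "exp (8 * lam) \<le> exp (8 * exp (-x))" by simp
    have "exp 1 \<le> real n" using exp_le n by linarith
    then have ln1: "1 \<le> ln (real n)"
      using n by (simp add: ln_ge_iff)
    have "1 / real n + 4 * real s * real k / (real n)\<^sup>2 = (1 + 4 * (ln (real n) + x)) / real n"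
      using n assms by (simp add: k power2_eq_square field_simps)
    also have "\<dots> \<le> (5 + 4 * \<bar>x\<bar>) * ln (real n) / real n"
    proof (rule divide_right_mono)
      have "\<bar>x\<bar> \<le> \<bar>x\<bar> * ln (real n)" using mult_left_mono[OF ln1, of "\<bar>x\<bar>"] by simp
      then show "1 + 4 * (ln (real n) + x) \<le> (5 + 4 * \<bar>x\<bar>) * ln (real n)"
        unfolding distrib_right using ln1 by (simp add: mult.assoc)
    qed simp
    finally have "(1 / real n + 4 * real s * real k / (real n)\<^sup>2) * exp (8 * lam) \<le>
        (5 + 4 * \<bar>x\<bar>) * ln (real n) / real n * exp (8 * exp (-x))"
      using el ln1 by (intro mult_mono) auto
    also have "\<dots> = ?C * (ln (real n) / real n)" by simp
    finally show ?thesis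
      using tv_dist_empty_cells_poisson[OF n(1-3) lam] by linarith
  qed
  moreover have "?C > 0" by (intro mult_pos_pos) auto
  ultimately show ?thesis
    unfolding Let_def by blast
qed

end
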